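(* There is no stable base $\mathcal{B}$ such that the law $\neg_\rho\neg_\rho A\ \vdash_\rho\ A$ holds (i.e. is true for every algorithmic statement $A$) for all $\mathcal{B}$-libraries $\rho$. In particular, no stable base contains Rule $P_5$, the rule implementing the diagram $\neg_\rho\neg_\rho A\,/\,A$.
   Context: Framework. Algorithms are recursive algorithms in a fixed standard model. A datum is anything that can be input to an algorithm; data include natural numbers and algorithms, and every finite list of data is a datum. Every algorithm accepts exactly one input datum and either does not halt or halts with exactly one output datum. Every datum has a positive integer size, only finitely many data have a given size, and the size of a list is strictly greater than the sum of the sizes of its items. A process is a pair (algorithm, input). Every halting process has a positive integer runtime; if a process runs subprocesses in its execution, its runtime is strictly greater than the sum of the runtimes of the halting subprocesses. An algorithmic statement is a datum $[\alpha,u,v]$ with $\alpha$ an algorithm, asserting that $\alpha$ with input $u$ halts with output $v$; it is true if this is so and false otherwise. To say that an algorithmic statement holds is to say that it is true. $\mathcal{F}$ denotes the false statement $[\mathrm{identity},0,1]$, where $\mathrm{identity}$ outputs a copy of its input. Rules and libraries. An algorithmic sequence is an algorithm $\rho$ that halts on every positive integer $n$; its output is written $\rho_n$. A rule is an algorithm which, on every input $[H,\rho,m]$ with $H$ a finite list of algorithmic statements (hypothesis list), $\rho$ an algorithmic sequence (nominal library) and $m$ a positive integer (resource integer), halts and outputs a list of algorithmic statements (conclusion list) having $H$ as an initial sublist, and which is monotone: if $m'\ge m$ and every item of $H$ is an item of $H'$, then every item of the output on $[H,\rho,m]$ is an item of the output on $[H',\rho,m']$. A library is an algorithmic sequence $\rho$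 such that every $\rho_n$ is a rule (not necessarily distinct); the $\rho_n$ are the rules contained in $\rho$. A rule is $\rho$-valid if for every list $H$ of true statements and every $m$, its output on $[H,\rho,m]$ consists only of true statements. A library $\rho$ is valid if all its rules are $\rho$-valid. Bases. A base is a set $\mathcal{B}$ of rules that is finite or is the set of terms of a library. A $\mathcal{B}$-library is a library containing all rules of $\mathcal{B}$. A $\mathcal{B}$-library $\rho$ is valid outside $\mathcal{B}$ if every rule in $\rho$ which is not in $\mathcal{B}$ is $\rho$-valid. A base $\mathcal{B}$ is stable if every $\mathcal{B}$-library that is valid outside $\mathcal{B}$ is valid. Deduction. Fix a recursive bijection $f:\mathbb{N}_+\to\mathbb{N}_+\times\mathbb{N}_+$. The algorithm $\mathrm{deduce}$, on input $[\Gamma,\rho,B]$ ($\Gamma$ a list of algorithmic statements, $\rho$ a library, $B$ an algorithmic statement), computes lists $H_0=\Gamma,H_1,H_2,\dots$, where for $i>0$ with $f(i)=(k,m)$ the list $H_i$ is the output of $\rho_k$ on $[H_{i-1},\rho,m]$; after computing each $H_i$ it checks whether $B$ is on $H_i$, outputs $1$ if so, and otherwise continues. The algorithmic statement $[\mathrm{deduce},[\Gamma,\rho,B],1]$ is denoted $\Gamma\vdash_\rho B$ (the notation is used for any datum $\rho$), and $A_1,\dots,A_n\vdash_\rho B$ means this with $\Gamma=[A_1,\dots,A_n]$. $A\Rightarrow_\rho B$ denotes $A\vdash_\rho B$, and $\neg_\rho A$ denotes $A\Rightarrow_\rho\mathcal{F}$. Rule diagrams. A rule implementing "$X_1,\dots,X_r\,/\,Y$"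 is the algorithm which on input $[H,\rho,m]$ outputs $H$ with $Y$ appended for every instance (letters ranging over algorithmic statements) whose premises $X_1,\dots,X_r$ are all on $H$; the $\rho$ in $\neg_\rho$ is the nominal library in the input. *)

theory Defs
  imports "HOL-Library.Nat_Bijection"
begin

section \<open>A model of computation\<close>

text \<open>
  The fixed standard model is a small LISP-like language: data are natural numbers, lists and
  algorithms, and every algorithm maps one datum to at most one datum.  Natural number
  arithmetic, list processing, branching and unbounded iteration make it Turing complete; Apply
  is the universal algorithm, and Explode and Implode give access to the text of an algorithm
  as data.
\<close>

datatype operation =
  Successor | Predecessor | Head | Tail | Equal | Kind | Explode | Implode

datatype datum = Nat nat | List "datum list" | Alg alg
  and alg =
    Identity
  | Const datum
  | Basic operation
  | Apply
  | Prepend alg alg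
  | Compose alg alg
  | Branch alg alg alg
  | While alg alg

fun op_code :: "operation \<Rightarrow> nat" where
  "op_code Successor = 0"
| "op_code Predecessor = 1"
| "op_code Head = 2"
| "op_code Tail = 3"
| "op_code Equal = 4"
| "op_code Kind = 5"
| "op_code Explode = 6"
| "op_code Implode = 7"

fun explode :: "alg \<Rightarrow> datum list" where
  "explode Identity = [Nat 0]"
| "explode (Const d) = [Nat 1, d]"
| "explode (Basic p) = [Nat 2, Nat (op_code p)]"
| "explode Apply = [Nat 3]"
| "explode (Prepend a b) = [Nat 4, Alg a, Alg b]"
| "explode (Compose a b) = [Nat 5, Alg a, Alg b]"
| "explode (Branch c a b) = [Nat 6, Alg c, Alg a, Alg b]"
| "explode (While c a) = [Nat 7, Alg c, Alg a]"

lemma op_code_eq_iff [simp]: "op_code p = op_code q \<longleftrightarrow> p = q"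
  by (cases p; cases q) simp_all

lemma explode_eq_iff [simp]: "explode a = explode b \<longleftrightarrow> a = b"
  by (cases a; cases b) simp_all

text \<open>Basic operations are total; on arguments of an unintended shape they yield 0.\<close>

fun perform :: "operation \<Rightarrow> datum \<Rightarrow> datum" where
  "perform Successor (Nat n) = Nat (Suc n)"
| "perform Predecessor (Nat n) = Nat (n - 1)"
| "perform Head (List (x # xs)) = x"
| "perform Tail (List (x # xs)) = List xs"
| "perform Equal (List [x, y]) = Nat (if x = y then 1 else 0)"
| "perform Kind (Nat n) = Nat 0"
| "perform Kind (List xs) = Nat 1"
| "perform Kind (Alg a) = Nat 2"
| "perform Explode (Alg a) = List (explode a)"
| "perform Implode (List xs) =
     (if \<exists>a. explode a = xs then Alg (THE a. explode a = xs) else Nat 0)"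
| "perform _ _ = Nat 0"

text \<open>
  \<open>runs a x v t\<close>: the process \<open>(a, x)\<close> halts with output \<open>v\<close> and runtime \<open>t\<close>.
\<close>

inductive runs :: "alg \<Rightarrow> datum \<Rightarrow> datum \<Rightarrow> nat \<Rightarrow> bool" where
  runs_Identity: "runs Identity x x 1"
| runs_Const: "runs (Const d) x d 1"
| runs_Basic: "runs (Basic p) x (perform p x) 1"
| runs_Apply: "runs a x v t \<Longrightarrow> runs Apply (List [Alg a, x]) v (t + 1)"
| runs_Prepend: "runs a x u s \<Longrightarrow> runs b x (List us) t \<Longrightarrow>
    runs (Prepend a b) x (List (u # us)) (s + t + 1)"
| runs_Compose: "runs b x u s \<Longrightarrow> runs a u v t \<Longrightarrow> runs (Compose a b) x v (s + t + 1)"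
| runs_Branch_then: "runs c x u s \<Longrightarrow> u \<noteq> Nat 0 \<Longrightarrow> runs a x v t \<Longrightarrow>
    runs (Branch c a b) x v (s + t + 1)"
| runs_Branch_else: "runs c x (Nat 0) s \<Longrightarrow> runs b x v t \<Longrightarrow>
    runs (Branch c a b) x v (s + t + 1)"
| runs_While_stop: "runs c x (Nat 0) s \<Longrightarrow> runs (While c a) x x (s + 1)"
| runs_While_step: "runs c x u r \<Longrightarrow> u \<noteq> Nat 0 \<Longrightarrow> runs a x y s \<Longrightarrow> runs (While c a) y v t \<Longrightarrow>
    runs (While c a) x v (r + s + t + 1)"

inductive_cases runs_IdentityE: "runs Identity x v t"
inductive_cases runs_ConstE: "runs (Const d) x v t"
inductive_cases runs_BasicE: "runs (Basic p) x v t"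
inductive_cases runs_ApplyE: "runs Apply x v t"
inductive_cases runs_PrependE: "runs (Prepend a b) x v t"
inductive_cases runs_ComposeE: "runs (Compose a b) x v t"
inductive_cases runs_BranchE: "runs (Branch c a b) x v t"
inductive_cases runs_WhileE: "runs (While c a) x v t"

lemma runs_deterministic: "runs a x v t \<Longrightarrow> runs a x v' t' \<Longrightarrow> v = v' \<and> t = t'"
proof (induction arbitrary: v' t' rule: runs.induct)
  case runs_Identity
  then show ?case by (auto elim: runs_IdentityE)
next
  case runs_Const
  then show ?case by (auto elim: runs_ConstE)
next
  case runs_Basic
  then show ?case by (auto elim: runs_BasicE)
next
  case runs_Apply
  from runs_Apply.prems show ?case
    by (rule runs_ApplyE) (auto dest: runs_Apply.IH)
next
  case (runs_Prepend a x u s b us t)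
  from runs_Prepend.prems obtain u' s' us' t'' where
    *: "v' = List (u' # us')" "t' = Suc (s' + t'')"
       "runs a x u' s'" "runs b x (List us') t''"
    by (rule runs_PrependE) simp
  from *(3) have "u = u' \<and> s = s'" by (rule runs_Prepend.IH(1))
  moreover from *(4) have "List us = List us' \<and> t = t''" by (rule runs_Prepend.IH(2))
  ultimately show ?case using * by simp
next
  case (runs_Compose b x u s a v t)
  from runs_Compose.prems obtain u' s' t'' where
    *: "runs b x u' s'" "runs a u' v' t''" "t' = Suc (s' + t'')"
    by (rule runs_ComposeE) simp
  from *(1) have u: "u = u' \<and> s = s'" by (rule runs_Compose.IH(1))
  with *(2) have "v = v' \<and> t = t''" by (intro runs_Compose.IH(2)) simp
  with u show ?case using * by simp
next
  case (runs_Branch_then c x u s a v t b)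
  note IH = runs_Branch_then.IH and nz = runs_Branch_then.hyps(2)
  from runs_Branch_then.prems show ?case
  proof (rule runs_BranchE)
    fix u' s' t'' assume *: "t' = Suc (s' + t'')" "runs c x u' s'" "runs a x v' t''"
    show ?case using IH(1)[OF *(2)] IH(2)[OF *(3)] *(1) by simp
  next
    fix s' t'' assume *: "runs c x (Nat 0) s'"
    show ?case using IH(1)[OF *] nz by simp
  qed
next
  case (runs_Branch_else c x s b v t a)
  note IH = runs_Branch_else.IH
  from runs_Branch_else.prems show ?case
  proof (rule runs_BranchE)
    fix u' s' t'' assume *: "runs c x u' s'" "u' \<noteq> Nat 0"
    show ?case using IH(1)[OF *(1)] *(2) by simp
  next
    fix s' t'' assume *: "t' = Suc (s' + t'')" "runs c x (Nat 0) s'" "runs b x v' t''"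
    show ?case using IH(1)[OF *(2)] IH(2)[OF *(3)] *(1) by simp
  qed
next
  case (runs_While_stop c x s a)
  note IH = runs_While_stop.IH
  from runs_While_stop.prems show ?case
  proof (rule runs_WhileE)
    fix s' assume *: "v' = x" "t' = Suc s'" "runs c x (Nat 0) s'"
    show ?case using IH[OF *(3)] *(1,2) by simp
  next
    fix u' r' y' s' t'' assume *: "runs c x u' r'" "u' \<noteq> Nat 0"
    show ?case using IH[OF *(1)] *(2) by simp
  qed
next
  case (runs_While_step c x u r a y s v t)
  note IH = runs_While_step.IH and nz = runs_While_step.hyps(2)
  from runs_While_step.prems show ?case
  proof (rule runs_WhileE)
    fix s' assume *: "runs c x (Nat 0) s'"
    show ?case using IH(1)[OF *] nz by simp
  next
    fix u' r' y' s' t''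
    assume *: "t' = Suc (r' + s' + t'')" "runs c x u' r'" "runs a x y' s'" "runs (While c a) y' v' t''"
    have "y = y' \<and> s = s'" by (rule IH(2)[OF *(3)])
    moreover from this *(4) have "v = v' \<and> t = t''" by (intro IH(3)) simp
    ultimately show ?case using IH(1)[OF *(2)] *(1) by simp
  qed
qed

lemma runtime_pos: "runs a x v t \<Longrightarrow> t > 0"
  by (induction rule: runs.induct) simp_all

primrec datum_size :: "datum \<Rightarrow> nat" and alg_size :: "alg \<Rightarrow> nat" where
  "datum_size (Nat n) = n + 1"
| "datum_size (List xs) = sum_list (map datum_size xs) + 1"
| "datum_size (Alg a) = alg_size a + 1"
| "alg_size Identity = 1"
| "alg_size (Const d) = datum_size d + 1"
| "alg_size (Basic p) = 1"
| "alg_size Apply = 1"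
| "alg_size (Prepend a b) = alg_size a + alg_size b + 1"
| "alg_size (Compose a b) = alg_size a + alg_size b + 1"
| "alg_size (Branch c a b) = alg_size c + alg_size a + alg_size b + 1"
| "alg_size (While c a) = alg_size c + alg_size a + 1"

definition outputs :: "alg \<Rightarrow> datum \<Rightarrow> datum \<Rightarrow> bool" where
  "outputs a x v \<longleftrightarrow> (\<exists>t. runs a x v t)"

lemma outputs_deterministic: "outputs a x v \<Longrightarrow> outputs a x v' \<Longrightarrow> v = v'"
  unfolding outputs_def using runs_deterministic by blast


section \<open>Algorithmic statements\<close>

definition statement :: "datum \<Rightarrow> bool" where
  "statement A \<longleftrightarrow> (\<exists>a u v. A = List [Alg a, u, v])"

definition holds :: "datum \<Rightarrow> bool" where
  "holds A \<longleftrightarrow> (\<exists>a u v. A = List [Alg a, u, v] \<and> outputs a u v)"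

definition falsum :: datum where
  "falsum = List [Alg Identity, Nat 0, Nat 1]"


section \<open>Rules, libraries and bases\<close>

definition algorithmic_sequence :: "alg \<Rightarrow> bool" where
  "algorithmic_sequence \<rho> \<longleftrightarrow> (\<forall>n>0. \<exists>v. outputs \<rho> (Nat n) v)"

definition rule_input :: "datum list \<Rightarrow> alg \<Rightarrow> nat \<Rightarrow> datum" where
  "rule_input H \<rho> m = List [List H, Alg \<rho>, Nat m]"

definition rule :: "alg \<Rightarrow> bool" where
  "rule r \<longleftrightarrow>
    (\<forall>H \<rho> m. (\<forall>A\<in>set H. statement A) \<and> algorithmic_sequence \<rho> \<and> m > 0 \<longrightarrow>
      (\<exists>K. outputs r (rule_input H \<rho> m) (List (H @ K)) \<and> (\<forall>A\<in>set K. statement A))) \<and>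
    (\<forall>H H' \<rho> m m' C C'. (\<forall>A\<in>set H. statement A) \<and> (\<forall>A\<in>set H'. statement A) \<and>
      algorithmic_sequence \<rho> \<and> m > 0 \<and> m \<le> m' \<and> set H \<subseteq> set H' \<and>
      outputs r (rule_input H \<rho> m) (List C) \<and> outputs r (rule_input H' \<rho> m') (List C') \<longrightarrow>
      set C \<subseteq> set C')"

definition rules_of :: "alg \<Rightarrow> alg set" where
  "rules_of \<rho> = {r. \<exists>n>0. outputs \<rho> (Nat n) (Alg r)}"

definition library :: "alg \<Rightarrow> bool" where
  "library \<rho> \<longleftrightarrow> (\<forall>n>0. \<exists>r. outputs \<rho> (Nat n) (Alg r) \<and> rule r)"

definition valid_rule :: "alg \<Rightarrow> alg \<Rightarrow> bool" where
  "valid_rule \<rho> r \<longleftrightarrow>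
    (\<forall>H m C. (\<forall>A\<in>set H. holds A) \<and> m > 0 \<and> outputs r (rule_input H \<rho> m) (List C) \<longrightarrow>
      (\<forall>A\<in>set C. holds A))"

definition valid_library :: "alg \<Rightarrow> bool" where
  "valid_library \<rho> \<longleftrightarrow> library \<rho> \<and> (\<forall>r\<in>rules_of \<rho>. valid_rule \<rho> r)"

definition base :: "alg set \<Rightarrow> bool" where
  "base \<B> \<longleftrightarrow> (\<forall>r\<in>\<B>. rule r) \<and> (finite \<B> \<or> (\<exists>\<rho>. library \<rho> \<and> \<B> = rules_of \<rho>))"

definition base_library :: "alg set \<Rightarrow> alg \<Rightarrow> bool" where
  "base_library \<B> \<rho> \<longleftrightarrow> library \<rho> \<and> \<B> \<subseteq> rules_of \<rho>"

definition valid_outside :: "alg set \<Rightarrow> alg \<Rightarrow> bool" where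
  "valid_outside \<B> \<rho> \<longleftrightarrow> (\<forall>r\<in>rules_of \<rho> - \<B>. valid_rule \<rho> r)"

definition stable :: "alg set \<Rightarrow> bool" where
  "stable \<B> \<longleftrightarrow> (\<forall>\<rho>. base_library \<B> \<rho> \<and> valid_outside \<B> \<rho> \<longrightarrow> valid_library \<rho>)"


section \<open>Deduction\<close>

definition recursive_bijection :: "(nat \<Rightarrow> nat \<times> nat) \<Rightarrow> bool" where
  "recursive_bijection f \<longleftrightarrow> bij_betw f {0<..} ({0<..} \<times> {0<..}) \<and>
    (\<exists>a. \<forall>n>0. outputs a (Nat n) (List [Nat (fst (f n)), Nat (snd (f n))]))"

text \<open>
  \<open>stages f \<Gamma> \<rho> Hs\<close>: the sequence \<open>Hs\<close> is the sequence of lists computed in a deduction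
  from \<open>\<Gamma>\<close> with library \<open>\<rho>\<close>.
\<close>

definition stages ::
  "(nat \<Rightarrow> nat \<times> nat) \<Rightarrow> datum list \<Rightarrow> alg \<Rightarrow> (nat \<Rightarrow> datum list) \<Rightarrow> bool" where
  "stages f \<Gamma> \<rho> Hs \<longleftrightarrow> Hs 0 = \<Gamma> \<and>
    (\<forall>i>0. \<forall>k m. f i = (k, m) \<longrightarrow>
      (\<exists>r. outputs \<rho> (Nat k) (Alg r) \<and> outputs r (rule_input (Hs (i - 1)) \<rho> m) (List (Hs i))))"

text \<open>
  The algorithm that carries out deductions is characterised by its input-output behaviour:
  results are stated for every algorithm with this behaviour.
\<close>

definition is_deduce :: "(nat \<Rightarrow> nat \<times> nat) \<Rightarrow> alg \<Rightarrow> bool" where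
  "is_deduce f deduce \<longleftrightarrow>
    (\<forall>\<Gamma> \<rho> B Hs v. (\<forall>A\<in>set \<Gamma>. statement A) \<and> library \<rho> \<and> statement B \<and> stages f \<Gamma> \<rho> Hs \<longrightarrow>
      (outputs deduce (List [List \<Gamma>, Alg \<rho>, B]) v \<longleftrightarrow> v = Nat 1 \<and> (\<exists>i>0. B \<in> set (Hs i))))"

definition entails :: "alg \<Rightarrow> datum list \<Rightarrow> datum \<Rightarrow> datum \<Rightarrow> datum" where
  "entails deduce \<Gamma> \<rho> B = List [Alg deduce, List [List \<Gamma>, \<rho>, B], Nat 1]"

definition implies :: "alg \<Rightarrow> datum \<Rightarrow> datum \<Rightarrow> datum \<Rightarrow> datum" where
  "implies deduce \<rho> A B = entails deduce [A] \<rho> B"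

definition neg :: "alg \<Rightarrow> datum \<Rightarrow> datum \<Rightarrow> datum" where
  "neg deduce \<rho> A = implies deduce \<rho> A falsum"


section \<open>Rule diagrams\<close>

text \<open>
  A diagram is given by its set of instances (list of premises, conclusion), which depends on
  the nominal library.  The order in which the conclusions are appended is left open.
\<close>

definition implements :: "alg \<Rightarrow> (alg \<Rightarrow> (datum list \<times> datum) set) \<Rightarrow> bool" where
  "implements r D \<longleftrightarrow>
    (\<forall>H \<rho> m. (\<forall>A\<in>set H. statement A) \<and> algorithmic_sequence \<rho> \<and> m > 0 \<longrightarrow>
      (\<exists>K. outputs r (rule_input H \<rho> m) (List (H @ K)) \<and>
        set K = {Y. \<exists>Xs. (Xs, Y) \<in> D \<rho> \<and> set Xs \<subseteq> set H}))"

definition double_negation_diagram :: "alg \<Rightarrow> alg \<Rightarrow> (datum list \<times> datum) set" where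
  "double_negation_diagram deduce \<rho> =
    {([neg deduce (Alg \<rho>) (neg deduce (Alg \<rho>) A)], A) | A. statement A}"

section \<open>Adequacy\<close>

text \<open>
  The facts below are not needed to state results.  They show that sizes and runtimes behave as
  expected, and that recursive bijections, deductions, deduction algorithms and rules
  implementing double negation elimination exist.
\<close>

lemma datum_size_pos: "datum_size d > 0"
  by (cases d) simp_all

lemma list_size_gt: "datum_size (List xs) > sum_list (map datum_size xs)"
  by simp

lemma alg_size_pos: "alg_size a > 0"
  by (cases a) simp_all

lemma length_le_size: "length xs \<le> sum_list (map datum_size xs)"
proof (induction xs)
  case (Cons x xs)
  then show ?case using datum_size_pos[of x] by simp
qed simp

lemma finite_sizes: "finite {d. datum_size d \<le> n} \<and> finite {a. alg_size a \<le> n}"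
proof (induction n)
  case 0
  have "{d. datum_size d \<le> 0} = {}" "{a. alg_size a \<le> 0} = {}"
    using datum_size_pos alg_size_pos by (simp_all add: not_le)
  then show ?case by (simp del: le_zero_eq)
next
  case (Suc n)
  define D where "D = {d. datum_size d \<le> n}"
  define A where "A = {a. alg_size a \<le> n}"
  define D' where "D' = Nat ` {..n} \<union> List ` {xs. set xs \<subseteq> D \<and> length xs \<le> n} \<union> Alg ` A"
  define A' where "A' = {Identity, Apply} \<union> Const ` D \<union>
    Basic ` {Successor, Predecessor, Head, Tail, Equal, Kind, Explode, Implode} \<union>
    case_prod Prepend ` (A \<times> A) \<union> case_prod Compose ` (A \<times> A) \<union>
    (\<lambda>(c, a, b). Branch c a b) ` (A \<times> A \<times> A) \<union> case_prod While ` (A \<times> A)"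
  have fin: "finite D" "finite A" using Suc by (simp_all add: D_def A_def)
  have subD: "{d. datum_size d \<le> Suc n} \<subseteq> D'"
  proof
    fix d assume "d \<in> {d. datum_size d \<le> Suc n}"
    then have d: "datum_size d \<le> Suc n" by simp
    show "d \<in> D'"
    proof (cases d)
      case (List xs)
      with d have *: "sum_list (map datum_size xs) \<le> n" by simp
      have "datum_size x \<le> n" if "x \<in> set xs" for x
        using member_le_sum_list[of "datum_size x" "map datum_size xs"] that * by simp
      then have "xs \<in> {xs. set xs \<subseteq> D \<and> length xs \<le> n}"
        using length_le_size[of xs] * by (simp add: D_def subset_iff)
      then show ?thesis using List by (simp add: D'_def)
    qed (use d in \<open>simp_all add: D'_def A_def\<close>)
  qed
  have finD: "finite D'"
    using fin by (simp add: D'_def finite_lists_length_le)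
  have subA: "{a. alg_size a \<le> Suc n} \<subseteq> A'"
  proof
    fix a assume "a \<in> {a. alg_size a \<le> Suc n}"
    then have a: "alg_size a \<le> Suc n" by simp
    show "a \<in> A'"
    proof (cases a)
      case (Basic p)
      then show ?thesis by (cases p) (simp_all add: A'_def)
    next
      case (Prepend b c)
      with a have "(b, c) \<in> A \<times> A" by (simp add: A_def)
      then have "a \<in> case_prod Prepend ` (A \<times> A)"
        using Prepend by (intro image_eqI[of _ _ "(b, c)"]) simp_all
      then show ?thesis unfolding A'_def by blast
    next
      case (Compose b c)
      with a have "(b, c) \<in> A \<times> A" by (simp add: A_def)
      then have "a \<in> case_prod Compose ` (A \<times> A)"
        using Compose by (intro image_eqI[of _ _ "(b, c)"]) simp_all
      then show ?thesis unfolding A'_def by blast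
    next
      case (Branch b c d)
      with a have "(b, c, d) \<in> A \<times> A \<times> A" by (simp add: A_def)
      then have "a \<in> (\<lambda>(c, a, b). Branch c a b) ` (A \<times> A \<times> A)"
        using Branch by (intro image_eqI[of _ _ "(b, c, d)"]) simp_all
      then show ?thesis unfolding A'_def by blast
    next
      case (While b c)
      with a have "(b, c) \<in> A \<times> A" by (simp add: A_def)
      then have "a \<in> case_prod While ` (A \<times> A)"
        using While by (intro image_eqI[of _ _ "(b, c)"]) simp_all
      then show ?thesis unfolding A'_def by blast
    qed (use a in \<open>simp_all add: A'_def D_def image_iff\<close>)
  qed
  have finA: "finite A'" using fin by (simp add: A'_def)
  show ?case using finite_subset[OF subD finD] finite_subset[OF subA finA] by (rule conjI)
qed

lemma outputs_simps [simp]: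
  "outputs Identity x v \<longleftrightarrow> v = x"
  "outputs (Const d) x v \<longleftrightarrow> v = d"
  "outputs (Basic p) x v \<longleftrightarrow> v = perform p x"
  "outputs Apply (List [Alg a, x]) v \<longleftrightarrow> outputs a x v"
  "outputs (Prepend a b) x v \<longleftrightarrow>
    (\<exists>u us. outputs a x u \<and> outputs b x (List us) \<and> v = List (u # us))"
  "outputs (Compose a b) x v \<longleftrightarrow> (\<exists>u. outputs b x u \<and> outputs a u v)"
  "outputs (Branch c a b) x v \<longleftrightarrow>
    (\<exists>u. outputs c x u \<and> (if u = Nat 0 then outputs b x v else outputs a x v))"
  unfolding outputs_def
        apply (blast intro: runs.intros elim: runs_IdentityE)
       apply (blast intro: runs.intros elim: runs_ConstE)
      apply (blast intro: runs.intros elim: runs_BasicE)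
     apply (blast intro: runs.intros elim: runs_ApplyE)
    apply (blast intro: runs.intros elim: runs_PrependE)
   apply (blast intro: runs.intros elim: runs_ComposeE)
  apply (auto intro: runs.intros elim!: runs_BranchE split: if_splits)
  done

lemma outputs_While:
  "outputs (While c a) x v \<longleftrightarrow>
    (\<exists>u. outputs c x u \<and>
      (if u = Nat 0 then v = x else \<exists>y. outputs a x y \<and> outputs (While c a) y v))"
proof
  assume "outputs (While c a) x v"
  then obtain t where "runs (While c a) x v t" by (auto simp: outputs_def)
  then show "\<exists>u. outputs c x u \<and>
      (if u = Nat 0 then v = x else \<exists>y. outputs a x y \<and> outputs (While c a) y v)"
    unfolding outputs_def by (rule runs_WhileE) (metis, metis)
next
  assume "\<exists>u. outputs c x u \<and>
      (if u = Nat 0 then v = x else \<exists>y. outputs a x y \<and> outputs (While c a) y v)"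
  then show "outputs (While c a) x v"
    unfolding outputs_def by (metis runs_While_stop runs_While_step)
qed

lemma outputs_iff: "outputs a x v \<Longrightarrow> outputs a x w \<longleftrightarrow> w = v"
  using outputs_deterministic by blast

fun tuple :: "alg list \<Rightarrow> alg" where
  "tuple [] = Const (List [])"
| "tuple (a # as) = Prepend a (tuple as)"

fun item :: "nat \<Rightarrow> alg" where
  "item 0 = Basic Head"
| "item (Suc i) = Compose (item i) (Basic Tail)"

fun component :: "nat \<Rightarrow> datum \<Rightarrow> datum" where
  "component 0 x = perform Head x"
| "component (Suc i) x = component i (perform Tail x)"

lemma outputs_item [simp]: "outputs (item i) x v \<longleftrightarrow> v = component i x"
  by (induction i arbitrary: x) auto

lemma component_List [simp]: "i < length xs \<Longrightarrow> component i (List xs) = xs ! i"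
proof (induction i arbitrary: xs)
  case 0
  then show ?case by (cases xs) simp_all
next
  case (Suc i)
  then show ?case by (cases xs) simp_all
qed

definition equals :: "alg \<Rightarrow> alg \<Rightarrow> alg" where
  "equals a b = Compose (Basic Equal) (tuple [a, b])"

lemma outputs_equals:
  assumes "\<And>v. outputs a x v \<longleftrightarrow> v = c" "\<And>v. outputs b x v \<longleftrightarrow> v = d"
  shows "outputs (equals a b) x v \<longleftrightarrow> v = Nat (if c = d then 1 else 0)"
  by (simp add: equals_def assms)

text \<open>Iteration over a list, with an accumulator and a constant environment.\<close>

definition fold_list :: "alg \<Rightarrow> alg" where
  "fold_list a = Compose (item 1)
    (While (Branch (equals (item 0) (Const (List []))) (Const (Nat 0)) (Const (Nat 1)))
      (tuple [Compose (Basic Tail) (item 0), Compose a (tuple [Compose (Basic Head) (item 0), item 1, item 2]), item 2]))"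

lemma outputs_fold_list:
  assumes "\<And>x acc v. x \<in> set xs \<Longrightarrow> outputs a (List [x, c acc, e]) v \<longleftrightarrow> v = c (g x acc)"
  shows "outputs (fold_list a) (List [List xs, c acc, e]) v \<longleftrightarrow> v = c (fold g xs acc)"
proof -
  let ?w = "While (Branch (equals (item 0) (Const (List []))) (Const (Nat 0)) (Const (Nat 1)))
      (tuple [Compose (Basic Tail) (item 0), Compose a (tuple [Compose (Basic Head) (item 0), item 1, item 2]), item 2])"
  have "outputs ?w (List [List xs, c acc, e]) v \<longleftrightarrow> v = List [List [], c (fold g xs acc), e]" for v
    using assms
  proof (induction xs arbitrary: acc)
    case Nil
    then show ?case by (subst outputs_While) (simp add: equals_def)
  next
    case (Cons x xs)
    have "outputs ?w (List [List xs, c (g x acc), e]) v \<longleftrightarrow>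
        v = List [List [], c (fold g xs (g x acc)), e]"
      using Cons.prems by (intro Cons.IH) simp
    then show ?case by (subst outputs_While) (simp add: equals_def Cons.prems)
  qed
  then show ?thesis by (simp add: fold_list_def)
qed

definition not_member :: alg where
  "not_member = Compose (fold_list (Branch (equals (item 0) (item 2)) (Const (Nat 0)) (item 1)))
    (tuple [item 1, Const (Nat 1), item 0])"

lemma outputs_not_member:
  "outputs not_member (List [B, List H]) v \<longleftrightarrow> v = Nat (if B \<in> set H then 0 else 1)"
proof -
  have "fold (\<lambda>x acc. if x = B then 0 else acc) H n = (if B \<in> set H then 0 else n)" for n :: nat
    by (induction H arbitrary: n) auto
  moreover have "outputs (fold_list (Branch (equals (item 0) (item 2)) (Const (Nat 0)) (item 1)))
      (List [List H, Nat 1, B]) v \<longleftrightarrow> v = Nat (fold (\<lambda>x acc. if x = B then 0 else acc) H 1)" for v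
    by (rule outputs_fold_list[where c = Nat]) (simp add: equals_def)
  ultimately show ?thesis by (simp add: not_member_def)
qed

lemma stages_exist:
  assumes f: "recursive_bijection f" and \<rho>: "library \<rho>" and \<Gamma>: "\<forall>A\<in>set \<Gamma>. statement A"
  shows "\<exists>Hs. stages f \<Gamma> \<rho> Hs"
proof -
  define step where "step n H H' \<longleftrightarrow> (\<exists>r. outputs \<rho> (Nat (fst (f (Suc n)))) (Alg r) \<and>
      outputs r (rule_input H \<rho> (snd (f (Suc n)))) (List H'))" for n H H'
  have step: "\<exists>H'. (\<forall>A\<in>set H'. statement A) \<and> step n H H'" if H: "\<forall>A\<in>set H. statement A" for n H
  proof -
    have "bij_betw f {0<..} ({0<..} \<times> {0<..})"
      using f by (simp add: recursive_bijection_def)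
    from bij_betwE[OF this] have "f (Suc n) \<in> {0<..} \<times> {0<..}" by simp
    then have pos: "fst (f (Suc n)) > 0" "snd (f (Suc n)) > 0" by (auto simp: mem_Times_iff)
    obtain r where r: "outputs \<rho> (Nat (fst (f (Suc n)))) (Alg r)" "rule r"
      using \<rho> pos unfolding library_def by blast
    have "algorithmic_sequence \<rho>"
      using \<rho> unfolding library_def algorithmic_sequence_def by blast
    with r(2) H pos obtain K where
      K: "outputs r (rule_input H \<rho> (snd (f (Suc n)))) (List (H @ K))" "\<forall>A\<in>set K. statement A"
      unfolding rule_def by blast
    have "step n H (H @ K)" unfolding step_def using r(1) K(1) by blast
    moreover have "\<forall>A\<in>set (H @ K). statement A" using H K(2) by auto
    ultimately show ?thesis by blast
  qed
  define Hs where "Hs = rec_nat \<Gamma> (\<lambda>n H. SOME H'. (\<forall>A\<in>set H'. statement A) \<and> step n H H')"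
  have Hs_Suc: "Hs (Suc n) = (SOME H'. (\<forall>A\<in>set H'. statement A) \<and> step n (Hs n) H')" for n
    by (simp add: Hs_def)
  have stmt: "\<forall>A\<in>set (Hs n). statement A" for n
  proof (induction n)
    case 0
    then show ?case using \<Gamma> by (simp add: Hs_def)
  next
    case (Suc n)
    from someI_ex[OF step[OF this, of n]] show ?case unfolding Hs_Suc by (rule conjunct1)
  qed
  have "step n (Hs n) (Hs (Suc n))" for n
    using someI_ex[OF step[OF stmt, of n n]] by (simp only: Hs_Suc)
  then have "step (i - 1) (Hs (i - 1)) (Hs i)" if "i > 0" for i
    using that by (metis Suc_pred')
  moreover have "Hs 0 = \<Gamma>" by (simp add: Hs_def)
  ultimately show ?thesis
    unfolding stages_def step_def by (intro exI[of _ Hs]) (simp, metis fst_conv snd_conv)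
qed

text \<open>
  A deduction algorithm with states \<open>[H, \<rho>, B, i]\<close>; the parameter computes the bijection.
\<close>

definition deduce_step :: "alg \<Rightarrow> alg" where
  "deduce_step a = Compose
    (tuple [Compose Apply (tuple [Compose Apply (tuple [item 1, Compose (item 0) (item 4)]),
              tuple [item 0, item 1, Compose (item 1) (item 4)]]),
            item 1, item 2, item 3])
    (tuple [item 0, item 1, item 2, Compose (Basic Successor) (item 3),
            Compose a (Compose (Basic Successor) (item 3))])"

definition deduce_program :: "alg \<Rightarrow> alg" where
  "deduce_program a = Compose (Const (Nat 1))
    (Compose (While (Compose not_member (tuple [item 2, item 0])) (deduce_step a))
      (Compose (deduce_step a) (tuple [item 0, item 1, item 2, Const (Nat 0)])))"

lemma is_deduce_program:
  assumes bij: "bij_betw f {0<..} ({0<..} \<times> {0<..})"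
    and a: "\<forall>n>0. outputs a (Nat n) (List [Nat (fst (f n)), Nat (snd (f n))])"
  shows "is_deduce f (deduce_program a)"
  unfolding is_deduce_def
proof (intro allI impI, elim conjE)
  fix \<Gamma> \<rho> B Hs v
  assume Hs: "stages f \<Gamma> \<rho> Hs"
  define S where "S i = List [List (Hs i), Alg \<rho>, B, Nat i]" for i
  have step: "outputs (deduce_step a) (S i) v \<longleftrightarrow> v = S (Suc i)" for i v
  proof -
    obtain k m where km: "f (Suc i) = (k, m)" by fastforce
    with Hs obtain r where r: "outputs \<rho> (Nat k) (Alg r)"
      "outputs r (rule_input (Hs i) \<rho> m) (List (Hs (Suc i)))"
      unfolding stages_def by (metis diff_Suc_1 zero_less_Suc)
    have "outputs a (Nat (Suc i)) (List [Nat k, Nat m])"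
      using a[rule_format, of "Suc i"] km by simp
    note sub = this[THEN outputs_iff] r(1)[THEN outputs_iff] r(2)[THEN outputs_iff, unfolded rule_input_def]
    show ?thesis by (simp add: S_def deduce_step_def sub)
  qed
  let ?c = "Compose not_member (tuple [item 2, item 0])"
  have cond: "outputs ?c (S i) v \<longleftrightarrow> v = Nat (if B \<in> set (Hs i) then 0 else 1)" for i v
    by (simp add: S_def outputs_not_member)
  let ?w = "While ?c (deduce_step a)"
  have unfold: "outputs ?w (S i) v \<longleftrightarrow>
      (if B \<in> set (Hs i) then v = S i else outputs ?w (S (Suc i)) v)" for i v
    by (subst outputs_While) (simp only: cond step simp_thms datum.inject ex_simps split: if_split, simp)
  have found: "\<exists>i\<ge>j. B \<in> set (Hs i)" if "runs ?w (S j) y t" for j y t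
    using that
  proof (induction t arbitrary: j rule: less_induct)
    case (less t)
    show ?case
    proof (cases "B \<in> set (Hs j)")
      case False
      from less.prems show ?thesis
      proof (rule runs_WhileE)
        fix s assume "runs ?c (S j) (Nat 0) s"
        then have "outputs ?c (S j) (Nat 0)" by (auto simp only: outputs_def)
        with cond False have False by (metis datum.inject(1) zero_neq_one)
        then show ?thesis ..
      next
        fix u r z s t' assume *: "t = Suc (r + s + t')" "runs (deduce_step a) (S j) z s" "runs ?w z y t'"
        then have "outputs (deduce_step a) (S j) z" by (auto simp only: outputs_def)
        with step have "z = S (Suc j)" by blast
        with * less.IH[of t' "Suc j"] show ?thesis by (auto intro: Suc_leD)
      qed
    qed auto
  qed
  have halt: "\<exists>y. outputs ?w (S j) y" if "B \<in> set (Hs (j + n))" for j n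
    using that
  proof (induction n arbitrary: j)
    case 0
    then show ?case using unfold[of j] by auto
  next
    case (Suc n)
    then have "\<exists>y. outputs ?w (S (Suc j)) y" by simp
    then show ?case using unfold[of j] by auto
  qed
  have "(\<exists>y. outputs ?w (S (Suc 0)) y) \<longleftrightarrow> (\<exists>i>0. B \<in> set (Hs i))"
  proof
    assume "\<exists>y. outputs ?w (S (Suc 0)) y"
    then show "\<exists>i>0. B \<in> set (Hs i)" unfolding outputs_def using found by (meson Suc_le_eq)
  next
    assume "\<exists>i>0. B \<in> set (Hs i)"
    then obtain n where "B \<in> set (Hs (Suc 0 + n))" by (metis Suc_pred add_Suc add_0)
    then show "\<exists>y. outputs ?w (S (Suc 0)) y" by (rule halt)
  qed
  moreover have "S 0 = List [List \<Gamma>, Alg \<rho>, B, Nat 0]"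
    using Hs by (simp add: S_def stages_def)
  then have "outputs (Compose (deduce_step a) (tuple [item 0, item 1, item 2, Const (Nat 0)]))
      (List [List \<Gamma>, Alg \<rho>, B]) y \<longleftrightarrow> y = S (Suc 0)" for y
    using step[of 0] by simp
  ultimately show "outputs (deduce_program a) (List [List \<Gamma>, Alg \<rho>, B]) v \<longleftrightarrow>
      v = Nat 1 \<and> (\<exists>i>0. B \<in> set (Hs i))"
    unfolding deduce_program_def by (auto simp only: outputs_simps)
qed

lemma deduce_exists: "recursive_bijection f \<Longrightarrow> \<exists>deduce. is_deduce f deduce"
  unfolding recursive_bijection_def using is_deduce_program by blast


text \<open>An algorithm implementing double negation elimination.\<close>

definition neg_alg :: "alg \<Rightarrow> alg \<Rightarrow> alg \<Rightarrow> alg" where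
  "neg_alg deduce \<rho> a =
    tuple [Const (Alg deduce), tuple [tuple [a], \<rho>, Const falsum], Const (Nat 1)]"

lemma outputs_neg_alg:
  assumes "\<And>v. outputs a x v \<longleftrightarrow> v = A" "\<And>v. outputs r x v \<longleftrightarrow> v = \<rho>"
  shows "outputs (neg_alg deduce r a) x v \<longleftrightarrow> v = neg deduce \<rho> A"
  by (auto simp: neg_alg_def neg_def implies_def entails_def assms)

definition inner :: alg where
  "inner = Compose (item 0) (Compose (item 0) (item 1))"

definition double_negation_step :: "alg \<Rightarrow> alg" where
  "double_negation_step deduce =
    (let a = Compose inner (Compose inner (item 0)); ai = (\<lambda>i. Compose (item i) a) in
      Branch (equals (item 0) (neg_alg deduce (item 2) (neg_alg deduce (item 2) a)))
        (Branch (equals a (tuple [ai 0, ai 1, ai 2]))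
          (Branch (equals (Compose (Basic Kind) (ai 0)) (Const (Nat 2)))
            (Prepend a (item 1))
            (item 1))
          (item 1))
        (item 1))"

definition reverse :: alg where
  "reverse = fold_list (Prepend (item 0) (item 1))"

lemma outputs_reverse:
  "outputs reverse (List [List xs, List acc, e]) v \<longleftrightarrow> v = List (rev xs @ acc)"
proof -
  have "outputs reverse (List [List xs, List acc, e]) v \<longleftrightarrow> v = List (fold Cons xs acc)"
    unfolding reverse_def by (rule outputs_fold_list[where c = List]) simp
  then show ?thesis by (simp add: fold_Cons_rev)
qed

definition double_negation_program :: "alg \<Rightarrow> alg" where
  "double_negation_program deduce =
    Compose reverse (tuple
      [Compose (fold_list (double_negation_step deduce))
        (tuple [item 0, Compose reverse (tuple [item 0, Const (List []), Const (List [])]), item 1]),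
       Const (List []), Const (List [])])"

lemma statement_iff:
  "statement A \<longleftrightarrow> A = List [component 0 A, component 1 A, component 2 A] \<and>
    perform Kind (component 0 A) = Nat 2"
proof
  assume "A = List [component 0 A, component 1 A, component 2 A] \<and>
    perform Kind (component 0 A) = Nat 2"
  moreover from this obtain a where "component 0 A = Alg a"
    by (cases "component 0 A") auto
  ultimately show "statement A" by (metis statement_def)
qed (auto simp: statement_def)

lemma implements_double_negation_program:
  "implements (double_negation_program deduce) (double_negation_diagram deduce)"
  unfolding implements_def
proof (intro allI impI)
  fix H \<rho> and m :: nat
  define nn where "nn A = neg deduce (Alg \<rho>) (neg deduce (Alg \<rho>) A)" for A
  define un where "un x = component 0 (component 0 (component 1 (component 0 (component 0 (component 1 x)))))" for x
  define g where "g x acc = (if x = nn (un x) \<and> statement (un x) then un x # acc else acc)" for x acc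
  have step: "outputs (double_negation_step deduce) (List [x, List acc, Alg \<rho>]) v \<longleftrightarrow> v = List (g x acc)"
    for x acc v
  proof -
    let ?x = "List [x, List acc, Alg \<rho>]" and ?a = "Compose inner (Compose inner (item 0))"
    have a: "outputs ?a ?x v \<longleftrightarrow> v = un x" for v
      by (simp add: inner_def un_def)
    have n: "outputs (neg_alg deduce (item 2) (neg_alg deduce (item 2) ?a)) ?x v \<longleftrightarrow> v = nn (un x)" for v
      unfolding nn_def by (intro outputs_neg_alg a) simp_all
    have e1: "outputs (equals (item 0) (neg_alg deduce (item 2) (neg_alg deduce (item 2) ?a))) ?x v \<longleftrightarrow>
        v = Nat (if x = nn (un x) then 1 else 0)" for v
      by (intro outputs_equals n) simp
    have e2: "outputs (equals ?a (tuple [Compose (item 0) ?a, Compose (item 1) ?a, Compose (item 2) ?a])) ?x v \<longleftrightarrow>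
        v = Nat (if un x = List [component 0 (un x), component 1 (un x), component 2 (un x)] then 1 else 0)" for v
      by (intro outputs_equals a) (simp add: inner_def un_def)
    have e3: "outputs (equals (Compose (Basic Kind) (Compose (item 0) ?a)) (Const (Nat 2))) ?x v \<longleftrightarrow>
        v = Nat (if perform Kind (component 0 (un x)) = Nat 2 then 1 else 0)" for v
      by (intro outputs_equals) (simp_all add: inner_def un_def)
    have e4: "outputs (item 1) ?x v \<longleftrightarrow> v = List acc" for v
      by simp
    show ?thesis
      unfolding double_negation_step_def Let_def g_def statement_iff outputs_simps(5,7) e1 e2 e3 e4 a
      by auto
  qed
  have fold: "outputs (fold_list (double_negation_step deduce)) (List [List H, List (rev H), Alg \<rho>]) v \<longleftrightarrow>
      v = List (fold g H (rev H))" for v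
    by (rule outputs_fold_list[where c = List]) (rule step)
  have un_nn: "un (nn A) = A" for A
    by (simp add: un_def nn_def neg_def implies_def entails_def)
  have "\<exists>K. fold g xs acc = K @ acc \<and> set K = {A. statement A \<and> nn A \<in> set xs}" for xs acc
  proof (induction xs arbitrary: acc)
    case (Cons x xs)
    from Cons[of "g x acc"] obtain K where K: "fold g xs (g x acc) = K @ g x acc"
      "set K = {A. statement A \<and> nn A \<in> set xs}" by blast
    show ?case
    proof (cases "x = nn (un x) \<and> statement (un x)")
      case True
      then have "g x acc = un x # acc" by (simp add: g_def)
      with K un_nn True show ?thesis by (intro exI[of _ "K @ [un x]"]) auto
    next
      case False
      then have "g x acc = acc" by (auto simp: g_def)
      with K un_nn False show ?thesis by (intro exI[of _ K]) auto
    qed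
  qed simp
  from this[of H "rev H"] obtain K where K: "fold g H (rev H) = K @ rev H"
    "set K = {A. statement A \<and> nn A \<in> set H}" by blast
  have "outputs (double_negation_program deduce) (rule_input H \<rho> m) (List (H @ rev K))"
    by (simp add: double_negation_program_def rule_input_def outputs_reverse fold K)
  moreover have "set (rev K) = {Y. \<exists>Xs. (Xs, Y) \<in> double_negation_diagram deduce \<rho> \<and> set Xs \<subseteq> set H}"
    by (auto simp: K double_negation_diagram_def nn_def)
  ultimately show "\<exists>K. outputs (double_negation_program deduce) (rule_input H \<rho> m) (List (H @ K)) \<and>
      set K = {Y. \<exists>Xs. (Xs, Y) \<in> double_negation_diagram deduce \<rho> \<and> set Xs \<subseteq> set H}"
    by blast
qed

lemma implements_double_negation_rule:
  assumes "implements r (double_negation_diagram deduce)"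
  shows "rule r"
  unfolding rule_def
proof (intro conjI allI impI; elim conjE)
  fix H \<rho> and m :: nat
  assume "\<forall>A\<in>set H. statement A" "algorithmic_sequence \<rho>" "m > 0"
  with assms obtain K where "outputs r (rule_input H \<rho> m) (List (H @ K))"
    "set K = {Y. \<exists>Xs. (Xs, Y) \<in> double_negation_diagram deduce \<rho> \<and> set Xs \<subseteq> set H}"
    unfolding implements_def by blast
  moreover from this have "\<forall>A\<in>set K. statement A" by (auto simp: double_negation_diagram_def)
  ultimately show "\<exists>K. outputs r (rule_input H \<rho> m) (List (H @ K)) \<and> (\<forall>A\<in>set K. statement A)"
    by blast
next
  fix H H' \<rho> and m m' :: nat and C C'
  assume *: "\<forall>A\<in>set H. statement A" "\<forall>A\<in>set H'. statement A" "algorithmic_sequence \<rho>" "m > 0"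
    "m \<le> m'" "set H \<subseteq> set H'"
    and C: "outputs r (rule_input H \<rho> m) (List C)" "outputs r (rule_input H' \<rho> m') (List C')"
  obtain K where K: "outputs r (rule_input H \<rho> m) (List (H @ K))"
    "set K = {Y. \<exists>Xs. (Xs, Y) \<in> double_negation_diagram deduce \<rho> \<and> set Xs \<subseteq> set H}"
    using assms * unfolding implements_def by blast
  from * have "m' > 0" by simp
  with assms * obtain K' where K': "outputs r (rule_input H' \<rho> m') (List (H' @ K'))"
    "set K' = {Y. \<exists>Xs. (Xs, Y) \<in> double_negation_diagram deduce \<rho> \<and> set Xs \<subseteq> set H'}"
    unfolding implements_def by blast
  have "C = H @ K" "C' = H' @ K'"
    using outputs_deterministic C K(1) K'(1) by blast+
  moreover have "set K \<subseteq> set K'"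
    unfolding K(2) K'(2) using *(6) by (blast intro: subset_trans)
  ultimately show "set C \<subseteq> set C'" using *(6) by auto
qed

text \<open>Counting along antidiagonals is a recursive bijection.\<close>

fun diagonal_next :: "nat \<times> nat \<Rightarrow> nat \<times> nat" where
  "diagonal_next (k, m) = (if m = 1 then (1, k + 1) else (k + 1, m - 1))"

definition diagonal :: "nat \<Rightarrow> nat \<times> nat" where
  "diagonal n = (diagonal_next ^^ (n - 1)) (1, 1)"

definition diagonal_program :: alg where
  "diagonal_program = Compose (Basic Tail)
    (Compose (While (Basic Head)
      (Prepend (Compose (Basic Predecessor) (item 0))
        (Branch (equals (item 2) (Const (Nat 1)))
          (tuple [Const (Nat 1), Compose (Basic Successor) (item 1)])
          (tuple [Compose (Basic Successor) (item 1), Compose (Basic Predecessor) (item 2)]))))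
    (tuple [Basic Predecessor, Const (Nat 1), Const (Nat 1)]))"

lemma diagonal_conv:
  "diagonal n = (fst (prod_decode (n - 1)) + 1, snd (prod_decode (n - 1)) + 1)"
proof -
  have "(diagonal_next ^^ n) (1, 1) = (fst (prod_decode n) + 1, snd (prod_decode n) + 1)" for n
  proof (induction n)
    case 0
    then show ?case by (simp add: prod_decode_def prod_decode_aux.simps)
  next
    case (Suc n)
    obtain a b where ab: "prod_decode n = (a, b)" by fastforce
    then have n: "n = prod_encode (a, b)" by (metis prod_decode_inverse)
    have "Suc n = prod_encode (if b = 0 then (0, a + 1) else (a + 1, b - 1))"
      by (cases b) (simp_all add: n prod_encode_def)
    then have "prod_decode (Suc n) = (if b = 0 then (0, a + 1) else (a + 1, b - 1))"
      by simp
    then show ?case using Suc ab by auto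
  qed
  then show ?thesis by (simp add: diagonal_def)
qed

lemma recursive_bijection_diagonal: "recursive_bijection diagonal"
  unfolding recursive_bijection_def
proof
  have "diagonal = map_prod Suc Suc \<circ> prod_decode \<circ> (\<lambda>n. n - 1)"
    by (auto simp: diagonal_conv map_prod_def split: prod.splits)
  moreover have 1: "bij_betw (\<lambda>n::nat. n - 1) {0<..} UNIV"
    by (rule bij_betw_byWitness[where f' = Suc]) auto
  moreover have 2: "bij_betw (map_prod Suc Suc) UNIV ({0<..} \<times> {0<..})"
    by (rule bij_betw_byWitness[where f' = "map_prod (\<lambda>n. n - 1) (\<lambda>n. n - 1)"]) auto
  ultimately show "bij_betw diagonal {0<..} ({0<..} \<times> {0<..})"
    using bij_betw_trans[OF 1 bij_betw_trans[OF bij_prod_decode 2]] by (simp only: comp_assoc)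
next
  let ?w = "While (Basic Head)
      (Prepend (Compose (Basic Predecessor) (item 0))
        (Branch (equals (item 2) (Const (Nat 1)))
          (tuple [Const (Nat 1), Compose (Basic Successor) (item 1)])
          (tuple [Compose (Basic Successor) (item 1), Compose (Basic Predecessor) (item 2)])))"
  have "outputs ?w (List [Nat n, Nat k, Nat m]) (List [Nat 0, Nat (fst ((diagonal_next ^^ n) (k, m))),
      Nat (snd ((diagonal_next ^^ n) (k, m)))])" for n k m
  proof (induction n arbitrary: k m)
    case 0
    then show ?case by (subst outputs_While) simp
  next
    case (Suc n)
    then show ?case
      by (subst outputs_While) (simp add: equals_def funpow_Suc_right del: funpow.simps)
  qed
  then have "outputs diagonal_program (Nat n) (List [Nat (fst (diagonal n)), Nat (snd (diagonal n))])" for n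
    by (auto simp: diagonal_program_def diagonal_def intro!: exI)
  then show "\<exists>a. \<forall>n>0. outputs a (Nat n) (List [Nat (fst (diagonal n)), Nat (snd (diagonal n))])"
    by blast
qed

end

theory Submission
  imports Defs
begin

text \<open>
  This is a Loeb-style argument with \<open>G = \<not>\<^sub>\<rho>\<not>\<^sub>\<rho>\<F>\<close>.
  Extend the base by the single rule that outputs \<open>G\<close> unconditionally.  The law gives
  \<open>G \<turnstile>\<^sub>\<rho> \<F>\<close>, so with the new rule every hypothesis deduces \<open>\<F>\<close>, in particular
  \<open>\<not>\<^sub>\<rho>\<F>\<close> does; that is, \<open>G\<close> is true and the new rule is valid.
  By stability the whole library is valid, and then \<open>\<F>\<close> is true.
\<close>

section \<open>Elementary facts on statements, rules and libraries\<close>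

lemma statement_entails [simp]: "statement (entails deduce \<Gamma> \<rho> B)"
  by (simp add: statement_def entails_def)

lemma statement_neg [simp]: "statement (neg deduce \<rho> A)"
  by (simp add: neg_def implies_def)

lemma statement_falsum [simp]: "statement falsum"
  by (simp add: statement_def falsum_def)

lemma not_holds_falsum: "\<not> holds falsum"
  by (simp add: holds_def falsum_def)

lemma library_algorithmic_sequence: "library \<rho> \<Longrightarrow> algorithmic_sequence \<rho>"
  unfolding library_def algorithmic_sequence_def by blast

lemma library_rule:
  assumes "library \<rho>" "k > 0" "outputs \<rho> (Nat k) (Alg r)"
  shows "rule r"
proof -
  obtain s where "outputs \<rho> (Nat k) (Alg s)" "rule s"
    using assms(1,2) unfolding library_def by blast
  with outputs_deterministic[OF assms(3)] show ?thesis by auto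
qed

lemma rule_extends:
  assumes "rule r" "\<forall>A\<in>set H. statement A" "algorithmic_sequence \<rho>" "m > 0"
    "outputs r (rule_input H \<rho> m) (List C)"
  shows "set H \<subseteq> set C" "\<forall>A\<in>set C. statement A"
proof -
  obtain K where "outputs r (rule_input H \<rho> m) (List (H @ K))" "\<forall>A\<in>set K. statement A"
    using assms unfolding rule_def by blast
  moreover from this have "C = H @ K"
    using assms(5) outputs_deterministic by blast
  ultimately show "set H \<subseteq> set C" "\<forall>A\<in>set C. statement A"
    using assms(2) by auto
qed

lemma rule_mono:
  assumes "rule r" "\<forall>A\<in>set H. statement A" "\<forall>A\<in>set H'. statement A" "algorithmic_sequence \<rho>"
    "m > 0" "m \<le> m'" "set H \<subseteq> set H'"
    "outputs r (rule_input H \<rho> m) (List C)" "outputs r (rule_input H' \<rho> m') (List C')"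
  shows "set C \<subseteq> set C'"
proof -
  note mono = assms(1)[unfolded rule_def, THEN conjunct2, rule_format]
  show ?thesis by (rule mono[of H H' \<rho> m m']) (use assms in auto)
qed

section \<open>Fairness of the schedule of rules\<close>

lemma recursive_bijection_pos:
  assumes "recursive_bijection f" "i > 0" "f i = (k, m)"
  shows "k > 0" "m > 0"
proof -
  have "bij_betw f {0<..} ({0<..} \<times> {0<..})"
    using assms(1) by (simp add: recursive_bijection_def)
  from bij_betwE[OF this] assms(2,3) show "k > 0" "m > 0" by force+
qed

text \<open>Surjectivity gives an index to every pair, and finitely many indices use only finitely
  many resource integers. So each rule recurs arbitrarily late with arbitrarily large
  resources.\<close>

lemma recursive_bijection_unbounded:
  assumes f: "recursive_bijection f" and "k > 0"
  shows "\<exists>i>j. \<exists>m'\<ge>m. f i = (k, m')"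
proof -
  have bij: "bij_betw f {0<..} ({0<..} \<times> {0<..})"
    using f by (simp add: recursive_bijection_def)
  \<comment> \<open>\<open>m'\<close> is made to exceed every resource integer scheduled up to
    \<open>j\<close>. The index 0, outside the domain of the bijection, can only raise the
    maximum.\<close>
  let ?M = "snd ` f ` {..j}"
  define m' where "m' = Suc (m + Max ?M)"
  have "(k, m') \<in> f ` {0<..}"
    using bij assms(2) by (simp add: bij_betw_imp_surj_on m'_def)
  then obtain i where i: "f i = (k, m')" by force
  have "i > j"
  proof (rule ccontr)
    assume "\<not> j < i"
    then have "m' \<in> ?M" using i by (force intro: image_eqI[of _ snd "f i"])
    then have "m' \<le> Max ?M" by simp
    then show False by (simp add: m'_def)
  qed
  moreover have "m \<le> m'" by (simp add: m'_def)
  ultimately show ?thesis using i by blast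
qed

section \<open>Deductions in a fixed library\<close>

locale deduction =
  fixes f :: "nat \<Rightarrow> nat \<times> nat" and deduce \<rho> :: alg
  assumes f: "recursive_bijection f"
    and deduce: "is_deduce f deduce"
    and \<rho>: "library \<rho>"
begin

abbreviation ng :: "datum \<Rightarrow> datum" where
  "ng \<equiv> neg deduce (Alg \<rho>)"

lemma stages_obtain_rule:
  assumes "stages f \<Gamma> \<rho> Hs" "i > 0" "f i = (k, m)"
  obtains r where "outputs \<rho> (Nat k) (Alg r)" "rule r" "r \<in> rules_of \<rho>" "k > 0" "m > 0"
    "outputs r (rule_input (Hs (i - 1)) \<rho> m) (List (Hs i))"
proof -
  have km: "k > 0" "m > 0" using recursive_bijection_pos[OF f] assms by blast+
  obtain r where r: "outputs \<rho> (Nat k) (Alg r)"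
    "outputs r (rule_input (Hs (i - 1)) \<rho> m) (List (Hs i))"
    using assms unfolding stages_def by blast
  have "r \<in> rules_of \<rho>" using r(1) km unfolding rules_of_def by blast
  with that[of r] r km library_rule[OF \<rho> km(1) r(1)] show thesis by blast
qed

lemma stages_statement:
  assumes "stages f \<Gamma> \<rho> Hs" "\<forall>A\<in>set \<Gamma>. statement A"
  shows "\<forall>A\<in>set (Hs i). statement A"
proof (induction i)
  case 0
  then show ?case using assms by (simp add: stages_def)
next
  case (Suc i)
  obtain k m where "f (Suc i) = (k, m)" by fastforce
  then obtain r where "rule r" "m > 0" "outputs r (rule_input (Hs i) \<rho> m) (List (Hs (Suc i)))"
    using stages_obtain_rule[OF assms(1), of "Suc i"] by (metis diff_Suc_1 zero_less_Suc)
  then show ?case using rule_extends(2) Suc library_algorithmic_sequence[OF \<rho>] by blast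
qed

lemma stages_mono:
  assumes "stages f \<Gamma> \<rho> Hs" "\<forall>A\<in>set \<Gamma>. statement A" "i \<le> j"
  shows "set (Hs i) \<subseteq> set (Hs j)"
  using assms(3)
proof (induction j rule: dec_induct)
  case (step j)
  obtain k m where "f (Suc j) = (k, m)" by fastforce
  then obtain r where "rule r" "m > 0" "outputs r (rule_input (Hs j) \<rho> m) (List (Hs (Suc j)))"
    using stages_obtain_rule[OF assms(1), of "Suc j"] by (metis diff_Suc_1 zero_less_Suc)
  then have "set (Hs j) \<subseteq> set (Hs (Suc j))"
    using rule_extends(1) stages_statement[OF assms(1,2)] library_algorithmic_sequence[OF \<rho>]
    by blast
  with step.IH show ?case by blast
qed simp

lemma holds_entails_iff:
  assumes "stages f \<Gamma> \<rho> Hs" "\<forall>A\<in>set \<Gamma>. statement A" "statement B"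
  shows "holds (entails deduce \<Gamma> (Alg \<rho>) B) \<longleftrightarrow> (\<exists>i. B \<in> set (Hs i))"
proof -
  have "holds (entails deduce \<Gamma> (Alg \<rho>) B) \<longleftrightarrow>
      outputs deduce (List [List \<Gamma>, Alg \<rho>, B]) (Nat 1)"
    by (simp add: holds_def entails_def)
  also have "\<dots> \<longleftrightarrow> (\<exists>i>0. B \<in> set (Hs i))"
    using deduce assms \<rho> unfolding is_deduce_def by blast
  also have "\<dots> \<longleftrightarrow> (\<exists>i. B \<in> set (Hs i))"
    using stages_mono[OF assms(1,2) le_SucI[OF order_refl]] by blast
  finally show ?thesis .
qed

text \<open>Valid rules preserve truth from one stage to the next. Validity is a hypothesis here and
  not part of the locale, since deductions must be imitated before the extended library is known to
  be valid.\<close>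

lemma entails_sound:
  assumes "valid_library \<rho>" "\<forall>A\<in>set \<Gamma>. holds A" "statement B"
    "holds (entails deduce \<Gamma> (Alg \<rho>) B)"
  shows "holds B"
proof -
  have stmt: "\<forall>A\<in>set \<Gamma>. statement A"
    using assms(2) unfolding holds_def statement_def by blast
  obtain Hs where Hs: "stages f \<Gamma> \<rho> Hs" using stages_exist[OF f \<rho> stmt] by blast
  have "\<forall>A\<in>set (Hs i). holds A" for i
  proof (induction i)
    case 0
    then show ?case using Hs assms(2) by (simp add: stages_def)
  next
    case (Suc i)
    obtain k m where "f (Suc i) = (k, m)" by fastforce
    then obtain r where "r \<in> rules_of \<rho>" "m > 0"
      "outputs r (rule_input (Hs i) \<rho> m) (List (Hs (Suc i)))"
      using stages_obtain_rule[OF Hs, of "Suc i"] by (metis diff_Suc_1 zero_less_Suc)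
    with Suc assms(1) show ?case unfolding valid_library_def valid_rule_def by blast
  qed
  with holds_entails_iff[OF Hs stmt assms(3)] assms(4) show ?thesis by blast
qed

text \<open>
  A deduction reaching all of \<open>\<Gamma>\<close> can imitate a deduction from \<open>\<Gamma>\<close>, because every rule
  recurs later with an arbitrarily large resource integer.
\<close>

lemma entails_cut:
  assumes "\<forall>A\<in>set \<Gamma>. statement A" "\<forall>A\<in>set \<Gamma>'. statement A" "statement B"
    and Hs': "stages f \<Gamma>' \<rho> Hs'" and j: "set \<Gamma> \<subseteq> set (Hs' j)"
    and "holds (entails deduce \<Gamma> (Alg \<rho>) B)"
  shows "holds (entails deduce \<Gamma>' (Alg \<rho>) B)"
proof -
  obtain Hs where Hs: "stages f \<Gamma> \<rho> Hs" using stages_exist[OF f \<rho> assms(1)] by blast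
  have "\<exists>j. set (Hs i) \<subseteq> set (Hs' j)" for i
  proof (induction i)
    case 0
    then show ?case using Hs j by (auto simp: stages_def)
  next
    case (Suc i)
    then obtain j where j: "set (Hs i) \<subseteq> set (Hs' j)" by blast
    obtain k m where km: "f (Suc i) = (k, m)" by fastforce
    obtain r where r: "outputs \<rho> (Nat k) (Alg r)" "rule r" "k > 0" "m > 0"
      "outputs r (rule_input (Hs i) \<rho> m) (List (Hs (Suc i)))"
      using stages_obtain_rule[OF Hs _ km] by (metis diff_Suc_1 zero_less_Suc)
    obtain j' m' where j': "j' > j" "m' \<ge> m" "f j' = (k, m')"
      using recursive_bijection_unbounded[OF f r(3)] by blast
    from j'(1) have "j' > 0" by simp
    then obtain r' where r': "outputs \<rho> (Nat k) (Alg r')"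
      "outputs r' (rule_input (Hs' (j' - 1)) \<rho> m') (List (Hs' j'))"
      using stages_obtain_rule[OF Hs' _ j'(3)] by metis
    have "r' = r" using outputs_deterministic[OF r(1) r'(1)] by simp
    \<comment> \<open>The strict inequality \<open>j' > j\<close> matters: the rule acts on the
      stage before \<open>j'\<close>, which must already contain \<open>Hs i\<close>.\<close>
    moreover have "set (Hs i) \<subseteq> set (Hs' (j' - 1))"
      using j stages_mono[OF Hs' assms(2), of j "j' - 1"] j'(1) by fastforce
    ultimately have "set (Hs (Suc i)) \<subseteq> set (Hs' j')"
      using rule_mono[OF r(2) stages_statement[OF Hs assms(1)] stages_statement[OF Hs' assms(2)]
          library_algorithmic_sequence[OF \<rho>] r(4) j'(2) _ r(5)] r'(2) by blast
    then show ?case by blast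
  qed
  with holds_entails_iff[OF Hs] holds_entails_iff[OF Hs'] assms show ?thesis by blast
qed

lemma stages_apply_rule:
  assumes "stages f \<Gamma> \<rho> Hs" "r \<in> rules_of \<rho>"
  obtains i m where "m > 0" "outputs r (rule_input (Hs i) \<rho> m) (List (Hs (Suc i)))"
proof -
  obtain k where k: "k > 0" "outputs \<rho> (Nat k) (Alg r)"
    using assms(2) unfolding rules_of_def by blast
  obtain i m where i: "i > 0" "f i = (k, m)"
    using recursive_bijection_unbounded[OF f k(1)] by blast
  then obtain r' where r': "outputs \<rho> (Nat k) (Alg r')" "m > 0"
    "outputs r' (rule_input (Hs (i - 1)) \<rho> m) (List (Hs i))"
    using stages_obtain_rule[OF assms(1)] by metis
  have "r' = r" using outputs_deterministic[OF k(2) r'(1)] by simp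
  with r' i(1) that[of m "i - 1"] show thesis by simp
qed

text \<open>The premise persists from stage 0 until the schedule reaches \<open>r\<close>, which
  then appends \<open>A\<close>. Thus containing the rule forces the law.\<close>

lemma double_negation_law:
  assumes "implements r (double_negation_diagram deduce)" "r \<in> rules_of \<rho>" "statement A"
  shows "holds (entails deduce [ng (ng A)] (Alg \<rho>) A)"
proof -
  have stmt: "\<forall>X\<in>set [ng (ng A)]. statement X" by simp
  obtain Hs where Hs: "stages f [ng (ng A)] \<rho> Hs" using stages_exist[OF f \<rho> stmt] by blast
  obtain i m where i: "m > 0" "outputs r (rule_input (Hs i) \<rho> m) (List (Hs (Suc i)))"
    using stages_apply_rule[OF Hs assms(2)] .
  obtain K where K: "outputs r (rule_input (Hs i) \<rho> m) (List (Hs i @ K))"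
    "set K = {Y. \<exists>Xs. (Xs, Y) \<in> double_negation_diagram deduce \<rho> \<and> set Xs \<subseteq> set (Hs i)}"
    using assms(1) i(1) stages_statement[OF Hs stmt] library_algorithmic_sequence[OF \<rho>]
    unfolding implements_def by blast
  have "ng (ng A) \<in> set (Hs i)"
    using stages_mono[OF Hs stmt, of 0 i] Hs by (simp add: stages_def)
  then have "A \<in> set K"
    unfolding K(2) double_negation_diagram_def using assms(3) by auto
  moreover have "Hs (Suc i) = Hs i @ K" using outputs_deterministic[OF i(2) K(1)] by simp
  ultimately have "A \<in> set (Hs (Suc i))" by simp
  then show ?thesis using holds_entails_iff[OF Hs stmt assms(3)] by blast
qed

end

section \<open>The rule added to the base\<close>

text \<open>The library is read from the input, so the rule can be defined before the library that
  will contain it and no fixed point is needed. Appending is done by two reversals, the second with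
  the new statement as initial accumulator.\<close>

definition neg_neg_falsum_rule :: "alg \<Rightarrow> alg" where
  "neg_neg_falsum_rule deduce =
    Compose reverse (tuple
      [Compose reverse (tuple [item 0, Const (List []), Const (List [])]),
       tuple [neg_alg deduce (item 1) (neg_alg deduce (item 1) (Const falsum))],
       Const (List [])])"

lemma outputs_neg_neg_falsum_rule:
  "outputs (neg_neg_falsum_rule deduce) (rule_input H \<rho> m) v \<longleftrightarrow>
    v = List (H @ [neg deduce (Alg \<rho>) (neg deduce (Alg \<rho>) falsum)])"
proof -
  let ?x = "List [List H, Alg \<rho>, Nat m]"
  have "outputs (neg_alg deduce (item 1) (neg_alg deduce (item 1) (Const falsum))) ?x v \<longleftrightarrow>
      v = neg deduce (Alg \<rho>) (neg deduce (Alg \<rho>) falsum)" for v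
    by (intro outputs_neg_alg) simp_all
  then show ?thesis
    by (simp add: neg_neg_falsum_rule_def rule_input_def outputs_reverse)
qed

text \<open>Monotonicity holds because the appended statement depends only on the nominal
  library.\<close>

lemma rule_neg_neg_falsum_rule: "rule (neg_neg_falsum_rule deduce)"
  unfolding rule_def outputs_neg_neg_falsum_rule by auto

section \<open>Enlarging a base to a library by one rule\<close>

lemma library_insert:
  assumes "library \<rho>" "rule r"
  obtains \<rho>' where "library \<rho>'" "rules_of \<rho>' = insert r (rules_of \<rho>)"
proof -
  \<comment> \<open>The predecessor serves as the test: it is 0 at position 1, where
    \<open>r\<close> is placed, and otherwise gives the shifted position in
    \<open>\<rho>\<close>.\<close>
  define \<rho>' where "\<rho>' = Branch (Basic Predecessor) (Compose \<rho> (Basic Predecessor)) (Const (Alg r))"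
  have out: "outputs \<rho>' (Nat n) v \<longleftrightarrow> (if n \<le> 1 then v = Alg r else outputs \<rho> (Nat (n - 1)) v)"
    for n v by (auto simp: \<rho>'_def)
  have "library \<rho>'"
    unfolding library_def
  proof (intro allI impI)
    fix n :: nat
    assume "n > 0"
    show "\<exists>s. outputs \<rho>' (Nat n) (Alg s) \<and> rule s"
    proof (cases "n \<le> 1")
      case True
      then show ?thesis using assms(2) by (simp add: out)
    next
      case False
      then show ?thesis using assms(1) by (simp add: out library_def)
    qed
  qed
  moreover have "rules_of \<rho>' = insert r (rules_of \<rho>)"
  proof (intro equalityI subsetI)
    fix s assume "s \<in> rules_of \<rho>'"
    then obtain n where "n > 0" "outputs \<rho>' (Nat n) (Alg s)" by (auto simp: rules_of_def)
    then show "s \<in> insert r (rules_of \<rho>)"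
      unfolding out rules_of_def by (auto split: if_splits intro!: exI[of _ "n - 1"])
  next
    fix s assume "s \<in> insert r (rules_of \<rho>)"
    then consider "s = r" | n where "n > 0" "outputs \<rho> (Nat n) (Alg s)"
      by (auto simp: rules_of_def)
    then show "s \<in> rules_of \<rho>'"
    proof cases
      case 1
      then show ?thesis unfolding rules_of_def out by (auto intro!: exI[of _ 1])
    next
      case 2
      then show ?thesis unfolding rules_of_def out by (auto intro!: exI[of _ "Suc n"])
    qed
  qed
  ultimately show thesis by (rule that)
qed

text \<open>Equality of the rule sets, not mere inclusion, ensures that at most one rule outside the
  base has to be checked for validity.\<close>

lemma base_extend:
  assumes "base \<B>" "rule r"
  obtains \<rho> where "library \<rho>" "rules_of \<rho> = insert r \<B>"
proof -
  from assms(1) consider "finite \<B>" "\<forall>s\<in>\<B>. rule s" | \<rho> where "library \<rho>" "\<B> = rules_of \<rho>"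
    unfolding base_def by blast
  then have "\<exists>\<rho>. library \<rho> \<and> rules_of \<rho> = insert r \<B>"
  proof cases
    case 1
    then show ?thesis
    proof (induction rule: finite_induct)
      case empty
      then show ?case
        \<comment> \<open>A library contains at least one rule; over the empty base this is
          \<open>r\<close> itself, repeated at every position.\<close>
        using assms(2) by (intro exI[of _ "Const (Alg r)"]) (auto simp: library_def rules_of_def)
    next
      case (insert s \<B>)
      then obtain \<rho> where "library \<rho>" "rules_of \<rho> = insert r \<B>" by auto
      with insert.prems show ?case
        by (metis insert_commute insertI1 library_insert)
    qed
  next
    case 2
    then show ?thesis using library_insert[OF _ assms(2)] by metis
  qed
  with that show thesis by blast
qed

section \<open>The contradiction\<close>

text \<open>Both claims of the theorem reduce to the single instance \<open>falsum\<close> of the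
  law.\<close>

lemma stable_base_no_falsum_law:
  assumes f: "recursive_bijection f" and deduce: "is_deduce f deduce"
    and \<B>: "base \<B>" "stable \<B>"
    and law: "\<And>\<rho>. base_library \<B> \<rho> \<Longrightarrow>
      holds (entails deduce [neg deduce (Alg \<rho>) (neg deduce (Alg \<rho>) falsum)] (Alg \<rho>) falsum)"
  shows False
proof -
  obtain \<rho> where ext: "library \<rho>" "rules_of \<rho> = insert (neg_neg_falsum_rule deduce) \<B>"
    using base_extend[OF \<B>(1) rule_neg_neg_falsum_rule] .
  then have lib: "base_library \<B> \<rho>" by (auto simp: base_library_def)
  interpret deduction f deduce \<rho> using f deduce ext(1) by unfold_locales
  let ?G = "ng (ng falsum)"
  obtain Hs where Hs: "stages f [ng falsum] \<rho> Hs"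
    using stages_exist[OF f ext(1), of "[ng falsum]"] by auto
  obtain i m where "outputs (neg_neg_falsum_rule deduce) (rule_input (Hs i) \<rho> m) (List (Hs (Suc i)))"
    using stages_apply_rule[OF Hs, of "neg_neg_falsum_rule deduce"] ext(2) by (metis insertI1)
  then have "set [?G] \<subseteq> set (Hs (Suc i))" by (simp add: outputs_neg_neg_falsum_rule)
  \<comment> \<open>The deduction from \<open>ng falsum\<close> has reached \<open>?G\<close>, so it
    can imitate the deduction of \<open>falsum\<close> from \<open>?G\<close> given by the law. The
    resulting entailment is \<open>?G\<close> itself, unfolded.\<close>
  from entails_cut[OF _ _ _ Hs this law[OF lib]]
  have "holds (entails deduce [ng falsum] (Alg \<rho>) falsum)" by simp
  then have G: "holds ?G" by (simp add: neg_def implies_def)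
  then have "valid_rule \<rho> (neg_neg_falsum_rule deduce)"
    unfolding valid_rule_def outputs_neg_neg_falsum_rule by auto
  \<comment> \<open>Should the new rule already lie in \<open>\<B>\<close>, nothing remains outside
    and the claim is vacuous.\<close>
  then have "valid_outside \<B> \<rho>" using ext(2) by (auto simp: valid_outside_def)
  with \<B>(2) lib have "valid_library \<rho>" unfolding stable_def by blast
  from entails_sound[OF this _ _ law[OF lib]] G have "holds falsum" by simp
  with not_holds_falsum show False ..
qed

theorem corollary14p7:
  fixes f :: "nat \<Rightarrow> nat \<times> nat" and deduce :: alg
  assumes "recursive_bijection f" and "is_deduce f deduce"
  shows "\<not> (\<exists>\<B>. base \<B> \<and> stable \<B> \<and>
            (\<forall>\<rho>. base_library \<B> \<rho> \<longrightarrow>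
              (\<forall>A. statement A \<longrightarrow>
                holds (entails deduce [neg deduce (Alg \<rho>) (neg deduce (Alg \<rho>) A)] (Alg \<rho>) A))))
         \<and> \<not> (\<exists>\<B> r. base \<B> \<and> stable \<B> \<and>
            implements r (double_negation_diagram deduce) \<and> r \<in> \<B>)"
proof (intro conjI notI; elim exE conjE)
  fix \<B>
  assume "base \<B>" "stable \<B>" "\<forall>\<rho>. base_library \<B> \<rho> \<longrightarrow>
    (\<forall>A. statement A \<longrightarrow>
      holds (entails deduce [neg deduce (Alg \<rho>) (neg deduce (Alg \<rho>) A)] (Alg \<rho>) A))"
  then show False using stable_base_no_falsum_law[OF assms] statement_falsum by blast
next
  fix \<B> r
  assume \<B>: "base \<B>" "stable \<B>" and r: "implements r (double_negation_diagram deduce)" "r \<in> \<B>"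
  \<comment> \<open>Every \<open>\<B>\<close>-library contains \<open>r\<close>, so the second claim
    falls under the same contradiction.\<close>
  have "holds (entails deduce [neg deduce (Alg \<rho>) (neg deduce (Alg \<rho>) falsum)] (Alg \<rho>) falsum)"
    if "base_library \<B> \<rho>" for \<rho>
  proof -
    interpret deduction f deduce \<rho>
      using assms that by unfold_locales (auto simp: base_library_def)
    show ?thesis
      using double_negation_law[OF r(1)] r(2) that by (auto simp: base_library_def)
  qed
  then show False using stable_base_no_falsum_law[OF assms \<B>] by blast
qed

end
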